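(* Let $\lambda>0$ and let $X_{1,1},X_{1,2},X_{2,1},X_{2,2}$ be independent random variables, each exponentially distributed with density $\lambda\exp(-\lambda x)$, $x\ge 0$. Let $\tilde X$ be the first factor of the larger of the two products $X_{1,1}X_{1,2}$ and $X_{2,1}X_{2,2}$. Then $\tilde X$ has density $$f_{\tilde X}(x)=2\lambda^2x\,E_1(\lambda x),\qquad x>0.$$
   Context: The first factor of the larger product is $\tilde X:=X_{J,1}$, where $J\in\{1,2\}$ is the almost surely unique index maximizing $X_{j,1}X_{j,2}$. $E_1(x)=\int_x^\infty\frac{\exp(-t)}{t}\,dt$ is the exponential integral. *)

theory Defs
  imports "HOL-Probability.Probability"
begin

text \<open>Only meaningful for \<open>x > 0\<close>: for \<open>x \<le> 0\<close> the integrand is not integrable and the Lebesgue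
  integral takes its default value \<open>0\<close>.\<close>

definition expint_E1 :: "real \<Rightarrow> real" where
  "expint_E1 x = (LBINT t:{x..}. exp (- t) / t)"

text \<open>\<open>J\<close> is a random index in \<open>{1, 2}\<close> that almost surely maximizes \<open>X j 1 * X j 2\<close>.
  How ties are broken is left open.\<close>

definition larger_product_index ::
    "'a measure \<Rightarrow> (nat \<Rightarrow> nat \<Rightarrow> 'a \<Rightarrow> real) \<Rightarrow> ('a \<Rightarrow> nat) \<Rightarrow> bool" where
  "larger_product_index M X J \<longleftrightarrow>
     J \<in> measurable M (count_space {1, 2}) \<and>
     (AE \<omega> in M. is_arg_max (\<lambda>j. X j 1 \<omega> * X j 2 \<omega>) (\<lambda>j. j \<in> {1, 2}) (J \<omega>))"

end

(* Proof idea: conditionally on X_{1,1} = x and (X_{2,1}, X_{2,2}) = (z, w), the first product wins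
   with probability P(X_{1,2} > z w / x) = exp (- l z w / x). Averaging over w gives x / (x + z),
   and averaging that over z gives l x exp (l x) E_1(l x). Multiplying by the density l exp (- l x)
   yields half of the claimed density; the two indices contribute equally, and ties have
   probability 0. *)

theory Submission
  imports Defs
begin

text \<open>Independence makes the joint law of the four variables a product measure, and Tonelli
  peels off one coordinate at a time. The first index listed becomes the outermost integral, so the
  order of integration is chosen through the order of the indices.\<close>

lemma (in prob_space) nn_integral_indep_vars_iid4:
  fixes Y :: "'i \<Rightarrow> 'a \<Rightarrow> real"
  assumes indep: "indep_vars (\<lambda>_. borel) Y {a, b, c, d}"
    and dist: "distinct [a, b, c, d]"
    and D: "\<And>i. i \<in> {a, b, c, d} \<Longrightarrow> distr M borel (Y i) = D"
    and f[measurable]: "f \<in> borel_measurable (borel \<Otimes>\<^sub>M borel \<Otimes>\<^sub>M borel \<Otimes>\<^sub>M borel)"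
  shows "(\<integral>\<^sup>+\<omega>. f (Y a \<omega>, Y b \<omega>, Y c \<omega>, Y d \<omega>) \<partial>M) =
    (\<integral>\<^sup>+x. \<integral>\<^sup>+y. \<integral>\<^sup>+z. \<integral>\<^sup>+w. f (x, y, z, w) \<partial>D \<partial>D \<partial>D \<partial>D)"
proof -
  let ?I = "{a, b, c, d}"
  have rv: "\<And>i. i \<in> ?I \<Longrightarrow> random_variable borel (Y i)"
    using indep unfolding indep_vars_def by auto
  have sD[measurable_cong]: "sets D = sets borel" using D[of a] by auto
  have pD: "prob_space D" using D[of a] prob_space_distr[OF rv[of a]] by auto
  interpret P: product_prob_space "\<lambda>_::'i. D"
    using pD by (auto simp: product_prob_space_def product_prob_space_axioms_def
      product_sigma_finite_def prob_space_imp_sigma_finite)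
  have "distr M (PiM ?I (\<lambda>_. borel)) (\<lambda>\<omega>. \<lambda>i\<in>?I. Y i \<omega>) = PiM ?I (\<lambda>i. distr M borel (Y i))"
    using indep rv by (subst (asm) indep_vars_iff_distr_eq_PiM') auto
  also have "\<dots> = PiM ?I (\<lambda>_. D)" by (rule PiM_cong) (auto simp: D)
  finally have eq: "PiM ?I (\<lambda>_. D) = distr M (PiM ?I (\<lambda>_. borel)) (\<lambda>\<omega>. \<lambda>i\<in>?I. Y i \<omega>)" ..
  have "(\<integral>\<^sup>+\<omega>. f (Y a \<omega>, Y b \<omega>, Y c \<omega>, Y d \<omega>) \<partial>M)
      = (\<integral>\<^sup>+v. f (v a, v b, v c, v d) \<partial>PiM ?I (\<lambda>_. D))"
    unfolding eq
    by (subst nn_integral_distr) (auto intro!: measurable_restrict rv)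
  also have "\<dots> = (\<integral>\<^sup>+x. \<integral>\<^sup>+y. \<integral>\<^sup>+z. \<integral>\<^sup>+w. f (x, y, z, w) \<partial>D \<partial>D \<partial>D \<partial>D)"
    \<comment> \<open>The reversed list supplies each inequality of indices in the opposite
      orientation as well, so that the freshness conditions and the function updates both
      simplify.\<close>
    using dist dist[unfolded distinct_rev[symmetric, of "[a, b, c, d]"]]
    by (simp add: P.product_nn_integral_insert_rev PiM_empty nn_integral_count_space_finite)
  finally show ?thesis .
qed

text \<open>\<open>expint_E1\<close> is a Bochner integral, which is meaningful only if the
  integrand is integrable. For t \<ge> x > 0 the integrand is at most exp(-t)/x, whose integral is
  finite, so the value agrees with the nonnegative integral used in the later computations.\<close>

lemma nn_integral_exp_div:
  assumes x: "x > 0"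
  shows "(\<integral>\<^sup>+t. ennreal (exp (- t) / t) * indicator {x..} t \<partial>lborel) = ennreal (expint_E1 x)"
proof -
  have lim: "((\<lambda>t. - exp (- t) / x) \<longlongrightarrow> 0) at_top"
  proof -
    have "((\<lambda>t::real. exp (- t)) \<longlongrightarrow> 0) at_top"
      using filterlim_compose[OF exp_at_bot filterlim_uminus_at_bot_at_top] by simp
    from tendsto_divide_zero[OF tendsto_minus[OF this, simplified], of x] show ?thesis by simp
  qed
  have "(\<integral>\<^sup>+t. ennreal (exp (- t) / t) * indicator {x..} t \<partial>lborel)
      \<le> (\<integral>\<^sup>+t. ennreal (exp (- t) / x) * indicator {x..} t \<partial>lborel)"
    using x by (intro nn_integral_mono) (auto simp: indicator_def intro!: ennreal_leI divide_left_mono)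
  also have "\<dots> = ennreal (0 - (- exp (- x) / x))"
    using x by (intro nn_integral_FTC_atLeast lim) (auto intro!: derivative_eq_intros)
  also have "\<dots> < \<infinity>" by simp
  finally have fin: "(\<integral>\<^sup>+t. ennreal (exp (- t) / t) * indicator {x..} t \<partial>lborel) < \<infinity>" .
  have eq: "(\<integral>\<^sup>+t. ennreal (exp (- t) / t) * indicator {x..} t \<partial>lborel)
      = (\<integral>\<^sup>+t. ennreal (indicator {x..} t * (exp (- t) / t)) \<partial>lborel)"
    by (intro nn_integral_cong) (auto simp: indicator_def)
  have nonneg: "AE t in lborel. 0 \<le> indicator {x..} t * (exp (- t) / t)"
    using x by (auto simp: indicator_def)
  have "integrable lborel (\<lambda>t. indicator {x..} t * (exp (- t) / t))"
    using fin unfolding eq by (intro integrableI_nonneg nonneg) auto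
  then show ?thesis
    unfolding eq expint_E1_def set_lebesgue_integral_def real_scaleR_def
    using nonneg by (rule nn_integral_eq_integral)
qed

lemma measurable_expint_E1[measurable]: "expint_E1 \<in> borel_measurable borel"
proof -
  \<comment> \<open>Turning the indicator into the condition \<open>x \<le> t\<close> exposes an
    integrand that is jointly measurable in \<open>x\<close> and \<open>t\<close>.\<close>
  have "expint_E1 = (\<lambda>x. LBINT t. (if x \<le> t then 1 else 0) * (exp (- t) / t))"
    unfolding expint_E1_def set_lebesgue_integral_def
    by (intro ext Bochner_Integration.integral_cong) (auto simp: indicator_def)
  also have "\<dots> \<in> borel_measurable borel" by measurable
  finally show ?thesis .
qed

lemma nn_integral_exponential_tail:
  assumes "l > 0" "a \<ge> 0"
  shows "(\<integral>\<^sup>+y. indicator {a<..} y \<partial>density lborel (\<lambda>x. ennreal (exponential_density l x)))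
    = ennreal (exp (- (l * a)))"
proof -
  let ?D = "density lborel (\<lambda>x. ennreal (exponential_density l x))"
  interpret D: prob_space ?D by (rule prob_space_exponential_density) fact
  \<comment> \<open>On the probability space \<open>?D\<close> itself, the identity is an
    exponential variable, so the known tail formula applies to it.\<close>
  have "distributed ?D lborel (\<lambda>x. x) (exponential_density l)"
    by (auto simp: distributed_def distr_id2 exponential_density_nonneg)
  from D.exponential_distributedD_gt[OF this assms(2,1)]
  show ?thesis by (simp add: D.emeasure_eq_measure greaterThan_def mult.commute)
qed

text \<open>Exponential tilting: the integrand times the density of rate \<open>l\<close> is 1/(1+s)
  times the density of rate \<open>l * (1 + s)\<close>, which has total mass 1.\<close>

lemma nn_integral_exponential_laplace:
  assumes "l > 0" "s \<ge> 0"
  shows "(\<integral>\<^sup>+w. ennreal (exp (- (l * (s * w)))) \<partial>density lborel (\<lambda>x. ennreal (exponential_density l x)))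
    = ennreal (1 / (1 + s))"
proof -
  have "(\<integral>\<^sup>+w. ennreal (exp (- (l * (s * w)))) \<partial>density lborel (\<lambda>x. ennreal (exponential_density l x)))
     = (\<integral>\<^sup>+w. ennreal (1 / (1 + s)) * ennreal (exponential_density (l * (1 + s)) w) \<partial>lborel)"
    using assms
    by (subst nn_integral_density)
      (auto intro!: nn_integral_cong simp: exponential_density_def ennreal_mult'[symmetric]
        exp_add[symmetric] algebra_simps divide_simps)
  also have "\<dots> = ennreal (1 / (1 + s)) * emeasure (density lborel (\<lambda>x. ennreal (exponential_density (l * (1 + s)) x))) UNIV"
    by (simp add: nn_integral_cmult emeasure_density)
  also have "\<dots> = ennreal (1 / (1 + s))"
    using prob_space.emeasure_space_1[OF prob_space_exponential_density[of "l * (1 + s)"]] assms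
    by simp
  finally show ?thesis .
qed

text \<open>This is where the exponential integral enters: the substitution t = lx + lz turns the
  mean of x/(x+z) into the integral of exp(-t)/t over t \<ge> lx.\<close>

lemma nn_integral_exponential_stieltjes:
  assumes l: "l > 0" and x: "x > 0"
  shows "(\<integral>\<^sup>+z. ennreal (x / (x + z)) \<partial>density lborel (\<lambda>x. ennreal (exponential_density l x)))
    = ennreal (l * x * exp (l * x) * expint_E1 (l * x))"
proof -
  \<comment> \<open>The integrand takes the form \<open>l * f (l * x + l * z)\<close> up to a
    constant, as the affine substitution requires. The indicator is 1 exactly for z \<ge> 0, the
    range where the density is not cut off to 0.\<close>
  have "(\<integral>\<^sup>+z. ennreal (x / (x + z)) \<partial>density lborel (\<lambda>x. ennreal (exponential_density l x)))
     = (\<integral>\<^sup>+z. ennreal (l * x * exp (l * x)) * (l * (ennreal (exp (- (l * x + l * z)) / (l * x + l * z)) * indicator {l * x..} (l * x + l * z))) \<partial>lborel)"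
  proof (subst nn_integral_density; (intro nn_integral_cong)?)
    fix z :: real
    have "l * exp (- z * l) * (x / (x + z))
        = l * x * exp (l * x) * (l * (exp (- (l * x + l * z)) / (l * x + l * z)))" if "z \<ge> 0"
    proof -
      have e: "exp (- z * l) = exp (l * x) * exp (- (l * x + l * z))"
        by (simp add: mult_exp_exp)
      have "x / (x + z) = l * x / (l * x + l * z)"
        using l by (simp flip: distrib_left)
      then show ?thesis unfolding e by simp
    qed
    then show "ennreal (exponential_density l z) * ennreal (x / (x + z)) = ennreal (l * x * exp (l * x)) *
        (l * (ennreal (exp (- (l * x + l * z)) / (l * x + l * z)) * indicator {l * x..} (l * x + l * z)))"
      using assms by (auto simp: exponential_density_def indicator_def zero_le_mult_iff
        simp flip: ennreal_mult')
  qed auto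
  also have "\<dots> = ennreal (l * x * exp (l * x)) * (\<integral>\<^sup>+t. ennreal (exp (- t) / t) * indicator {l * x..} t \<partial>lborel)"
    using assms
    by (subst nn_integral_real_affine[where c = l and t = "l * x"]) (auto simp: nn_integral_cmult)
  finally show ?thesis using assms by (simp add: nn_integral_exp_div ennreal_mult')
qed

lemma AE_exponential_pos: "AE x in density lborel (\<lambda>x. ennreal (exponential_density l x)). 0 < x"
proof -
  \<comment> \<open>The density vanishes on the negative axis but may be nonzero at 0; that single
    point is Lebesgue null.\<close>
  have "AE x in lborel. x \<noteq> (0::real)" by (rule AE_lborel_singleton)
  then show ?thesis
    by (subst AE_density) (auto simp: exponential_density_def elim!: eventually_mono split: if_splits)
qed

lemma AE_exponential_neq: "AE y in density lborel (\<lambda>x. ennreal (exponential_density l x)). y \<noteq> c"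
  using AE_lborel_singleton[of c] by (subst AE_density) (auto elim!: eventually_mono)

text \<open>The contribution of a single index, hence half of the target density: \<open>x\<close>
  and \<open>y\<close> are the factors of the winning product, \<open>z\<close> and \<open>w\<close>
  those of the losing one. Integrating over \<open>y\<close> first is convenient because, for the
  other values fixed and positive, the event is a half-line in \<open>y\<close>.\<close>

lemma nn_integral_larger_product:
  fixes A :: "real set"
  assumes l: "l > 0" and A[measurable]: "A \<in> sets borel"
  defines "D \<equiv> density lborel (\<lambda>x. ennreal (exponential_density l x))"
  shows "(\<integral>\<^sup>+x. \<integral>\<^sup>+z. \<integral>\<^sup>+w. \<integral>\<^sup>+y. of_bool (x \<in> A \<and> z * w < x * y) \<partial>D \<partial>D \<partial>D \<partial>D)
    = (\<integral>\<^sup>+x. ennreal (if x > 0 then l\<^sup>2 * x * expint_E1 (l * x) else 0) * indicator A x \<partial>lborel)"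
    (is "?L = _")
proof -
  interpret D: prob_space D unfolding D_def by (rule prob_space_exponential_density) fact
  have pos: "AE x in D. 0 < x" unfolding D_def by (rule AE_exponential_pos)
  have y: "(\<integral>\<^sup>+y. of_bool (x \<in> A \<and> z * w < x * y) \<partial>D) = indicator A x * ennreal (exp (- (l * (z / x * w))))"
    if "x > 0" "z > 0" "w > 0" for x z w
  proof -
    have "(\<integral>\<^sup>+y. of_bool (x \<in> A \<and> z * w < x * y) \<partial>D)
        = (\<integral>\<^sup>+y. indicator A x * indicator {z / x * w<..} y \<partial>D)"
      using that by (intro nn_integral_cong) (auto simp: indicator_def field_simps)
    also have "\<dots> = indicator A x * (\<integral>\<^sup>+y. indicator {z / x * w<..} y \<partial>D)"
      by (intro nn_integral_cmult) (auto simp: D_def)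
    finally show ?thesis
      unfolding D_def using that l by (subst (asm) nn_integral_exponential_tail) auto
  qed
  have w: "(\<integral>\<^sup>+w. \<integral>\<^sup>+y. of_bool (x \<in> A \<and> z * w < x * y) \<partial>D \<partial>D) = indicator A x * ennreal (x / (x + z))"
    if "x > 0" "z > 0" for x z
  proof -
    have "(\<integral>\<^sup>+w. \<integral>\<^sup>+y. of_bool (x \<in> A \<and> z * w < x * y) \<partial>D \<partial>D)
        = (\<integral>\<^sup>+w. indicator A x * ennreal (exp (- (l * (z / x * w)))) \<partial>D)"
      \<comment> \<open>The formula for the inner integral needs w > 0, which holds almost
        everywhere under \<open>D\<close>.\<close>
      using pos by (intro nn_integral_cong_AE) (auto simp: y that elim!: eventually_mono)
    also have "\<dots> = indicator A x * (\<integral>\<^sup>+w. ennreal (exp (- (l * (z / x * w)))) \<partial>D)"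
      by (intro nn_integral_cmult) (auto simp: D_def)
    also have "\<dots> = indicator A x * ennreal (1 / (1 + z / x))"
      unfolding D_def using that l by (subst nn_integral_exponential_laplace) auto
    also have "1 / (1 + z / x) = x / (x + z)" using that by (simp add: field_simps)
    finally show ?thesis .
  qed
  have z: "(\<integral>\<^sup>+z. \<integral>\<^sup>+w. \<integral>\<^sup>+y. of_bool (x \<in> A \<and> z * w < x * y) \<partial>D \<partial>D \<partial>D)
      = indicator A x * ennreal (l * x * exp (l * x) * expint_E1 (l * x))"
    if "x > 0" for x
  proof -
    have "(\<integral>\<^sup>+z. \<integral>\<^sup>+w. \<integral>\<^sup>+y. of_bool (x \<in> A \<and> z * w < x * y) \<partial>D \<partial>D \<partial>D)
        = (\<integral>\<^sup>+z. indicator A x * ennreal (x / (x + z)) \<partial>D)"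
      using pos by (intro nn_integral_cong_AE) (auto simp: w that elim!: eventually_mono)
    also have "\<dots> = indicator A x * (\<integral>\<^sup>+z. ennreal (x / (x + z)) \<partial>D)"
      by (intro nn_integral_cmult) (auto simp: D_def)
    finally show ?thesis
      unfolding D_def using that l by (subst (asm) nn_integral_exponential_stieltjes) auto
  qed
  \<comment> \<open>The value 0 for x \<le> 0 is free to choose, as \<open>D\<close> gives that
    half-line no mass.\<close>
  have "?L = (\<integral>\<^sup>+x. indicator A x * ennreal (if x > 0 then l * x * exp (l * x) * expint_E1 (l * x) else 0) \<partial>D)"
    using pos by (intro nn_integral_cong_AE) (auto simp: z elim!: eventually_mono)
  \<comment> \<open>The density of \<open>D\<close> cancels \<open>exp (l * x)\<close> and
    contributes the second factor \<open>l\<close>.\<close>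
  also have "\<dots> = (\<integral>\<^sup>+x. ennreal (if x > 0 then l\<^sup>2 * x * expint_E1 (l * x) else 0) * indicator A x \<partial>lborel)"
    unfolding D_def using l
    by (subst nn_integral_density)
      (auto intro!: nn_integral_cong simp: exponential_density_def indicator_def power2_eq_square
        mult_exp_exp exp_minus field_simps simp flip: ennreal_mult')
  finally show ?thesis .
qed

theorem mainTheorem11:
  fixes M :: "'a measure" and l :: real
    and X :: "nat \<Rightarrow> nat \<Rightarrow> 'a \<Rightarrow> real" and J :: "'a \<Rightarrow> nat"
  assumes "prob_space M"
    and "l > 0"
    and "prob_space.indep_vars M (\<lambda>_. borel) (\<lambda>(j, k). X j k) ({1, 2} \<times> {1, 2})"
    and "\<And>j k. j \<in> {1, 2} \<Longrightarrow> k \<in> {1, 2} \<Longrightarrow>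
           distributed M lborel (X j k) (\<lambda>x. ennreal (exponential_density l x))"
    and "larger_product_index M X J"
  shows "distributed M lborel (\<lambda>\<omega>. X (J \<omega>) 1 \<omega>)
           (\<lambda>x. ennreal (if x > 0 then 2 * l\<^sup>2 * x * expint_E1 (l * x) else 0))"
proof -
  interpret prob_space M by fact
  define D where "D = density lborel (\<lambda>x. ennreal (exponential_density l x))"
  \<comment> \<open>\<open>lborel\<close> and \<open>borel\<close> have the same measurable sets, so
    they give the same push-forward.\<close>
  have dist: "distr M borel (X j k) = D" if "j \<in> {1, 2}" "k \<in> {1, 2}" for j k
    using assms(4)[OF that] distr_cong[of M M borel lborel "X j k" "X j k"]
    by (simp add: distributed_def D_def)
  have X[measurable]: "X 1 1 \<in> borel_measurable M" "X 1 2 \<in> borel_measurable M"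
    "X 2 1 \<in> borel_measurable M" "X 2 2 \<in> borel_measurable M"
    using assms(4) by (auto simp: distributed_def)
  have J[measurable]: "J \<in> measurable M (count_space {1, 2})"
    and max: "AE \<omega> in M. is_arg_max (\<lambda>j. X j 1 \<omega> * X j 2 \<omega>) (\<lambda>j. j \<in> {1, 2}) (J \<omega>)"
    using assms(5) by (auto simp: larger_product_index_def)
  \<comment> \<open>The second factor of product \<open>i\<close> comes last, so that it is
    integrated first, as in the lemma on the larger product.\<close>
  have iid: "(\<integral>\<^sup>+\<omega>. f (X i 1 \<omega>, X j 1 \<omega>, X j 2 \<omega>, X i 2 \<omega>) \<partial>M) =
      (\<integral>\<^sup>+x. \<integral>\<^sup>+z. \<integral>\<^sup>+w. \<integral>\<^sup>+y. f (x, z, w, y) \<partial>D \<partial>D \<partial>D \<partial>D)"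
    if "i \<in> {1, 2}" "j \<in> {1, 2}" "i \<noteq> j" and "f \<in> borel_measurable (borel \<Otimes>\<^sub>M borel \<Otimes>\<^sub>M borel \<Otimes>\<^sub>M borel)"
    for i j and f :: "real \<times> real \<times> real \<times> real \<Rightarrow> ennreal"
    using nn_integral_indep_vars_iid4[of "\<lambda>(j, k). X j k" "(i, 1)" "(j, 1)" "(j, 2)" "(i, 2)" D f]
      indep_vars_subset[OF assms(3)] that dist by auto
  \<comment> \<open>With the other three factors fixed and x > 0, a tie forces y = zw/x, a single
    point, which has probability 0 under \<open>D\<close>.\<close>
  have tie: "AE \<omega> in M. X 1 1 \<omega> * X 1 2 \<omega> \<noteq> X 2 1 \<omega> * X 2 2 \<omega>"
  proof -
    have "(\<integral>\<^sup>+\<omega>. of_bool (X 2 1 \<omega> * X 2 2 \<omega> = X 1 1 \<omega> * X 1 2 \<omega>) \<partial>M)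
      = (\<integral>\<^sup>+x. \<integral>\<^sup>+z. \<integral>\<^sup>+w. \<integral>\<^sup>+y. of_bool (z * w = x * y) \<partial>D \<partial>D \<partial>D \<partial>D)"
      using iid[of 1 2 "\<lambda>(x, z, w, y). of_bool (z * w = x * y)"] by simp
    also have "\<dots> = (\<integral>\<^sup>+x. \<integral>\<^sup>+z. \<integral>\<^sup>+w. 0 \<partial>D \<partial>D \<partial>D)"
    proof -
      have "(\<integral>\<^sup>+y. of_bool (z * w = x * y) \<partial>D) = 0" if "0 < x" for x z w
      proof (rule nn_integral_zero')
        show "AE y in D. of_bool (z * w = x * y) = (0 :: ennreal)"
          using AE_exponential_neq[of "z * w / x" l] unfolding D_def
          by (rule eventually_mono) (use that in auto)
      qed
      then show ?thesis
        using AE_exponential_pos[of l] unfolding D_def[symmetric]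
        by (intro nn_integral_cong_AE) (auto elim!: eventually_mono)
    qed
    finally have "(\<integral>\<^sup>+\<omega>. of_bool (X 2 1 \<omega> * X 2 2 \<omega> = X 1 1 \<omega> * X 1 2 \<omega>) \<partial>M) = 0" by simp
    then show ?thesis by (subst (asm) nn_integral_0_iff_AE) (auto simp del: One_nat_def)
  qed
  have Xt: "(\<lambda>\<omega>. X (J \<omega>) 1 \<omega>) \<in> borel_measurable M"
  proof -
    \<comment> \<open>\<open>J\<close> takes only the values 1 and 2 on \<open>space M\<close>, so
      selecting by \<open>J\<close> is a two-way case distinction between measurable
      functions.\<close>
    have "(\<lambda>\<omega>. if J \<omega> = 1 then X 1 1 \<omega> else X 2 1 \<omega>) \<in> borel_measurable M" by measurable
    moreover have "(if J \<omega> = 1 then X 1 1 \<omega> else X 2 1 \<omega>) = X (J \<omega>) 1 \<omega>" if "\<omega> \<in> space M" for \<omega>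
      using measurable_space[OF J that] by auto
    ultimately show ?thesis by (rule measurable_cong[THEN iffD1, rotated])
  qed
  let ?g = "\<lambda>x. ennreal (if x > 0 then l\<^sup>2 * x * expint_E1 (l * x) else 0)"
  let ?f = "\<lambda>x. ennreal (if x > 0 then 2 * l\<^sup>2 * x * expint_E1 (l * x) else 0)"
  have "distr M lborel (\<lambda>\<omega>. X (J \<omega>) 1 \<omega>) = density lborel ?f"
  proof (rule measure_eqI)
    fix A assume "A \<in> sets (distr M lborel (\<lambda>\<omega>. X (J \<omega>) 1 \<omega>))"
    then have A[measurable]: "A \<in> sets borel" by simp
    have part: "(\<integral>\<^sup>+\<omega>. of_bool (X i 1 \<omega> \<in> A \<and> X j 1 \<omega> * X j 2 \<omega> < X i 1 \<omega> * X i 2 \<omega>) \<partial>M)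
        = (\<integral>\<^sup>+x. ?g x * indicator A x \<partial>lborel)" if "i \<in> {1, 2}" "j \<in> {1, 2}" "i \<noteq> j" for i j
      using iid[OF that, of "\<lambda>(x, z, w, y). of_bool (x \<in> A \<and> z * w < x * y)"]
        nn_integral_larger_product[OF assms(2) A] by (simp add: D_def)
    have "emeasure (distr M lborel (\<lambda>\<omega>. X (J \<omega>) 1 \<omega>)) A = (\<integral>\<^sup>+\<omega>. indicator A (X (J \<omega>) 1 \<omega>) \<partial>M)"
      using Xt by (simp add: nn_integral_distr flip: nn_integral_indicator)
    \<comment> \<open>Almost surely there is no tie, so exactly one of the two strict inequalities
      holds. It determines \<open>J\<close>, and the other summand vanishes.\<close>
    also have "\<dots> = (\<integral>\<^sup>+\<omega>. of_bool (X 1 1 \<omega> \<in> A \<and> X 2 1 \<omega> * X 2 2 \<omega> < X 1 1 \<omega> * X 1 2 \<omega>) +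
        of_bool (X 2 1 \<omega> \<in> A \<and> X 1 1 \<omega> * X 1 2 \<omega> < X 2 1 \<omega> * X 2 2 \<omega>) \<partial>M)"
      using max tie
      by (intro nn_integral_cong_AE, eventually_elim) (auto simp: is_arg_max_def indicator_def)
    also have "\<dots> = (\<integral>\<^sup>+x. ?g x * indicator A x \<partial>lborel) + (\<integral>\<^sup>+x. ?g x * indicator A x \<partial>lborel)"
      using part[of 1 2] part[of 2 1] by (subst nn_integral_add) (auto simp del: One_nat_def)
    also have "\<dots> = (\<integral>\<^sup>+x. ?g x * indicator A x + ?g x * indicator A x \<partial>lborel)"
      by (rule nn_integral_add[symmetric]) auto
    \<comment> \<open>The equal contributions of the two indices produce the factor 2 in the
      density.\<close>
    also have "\<dots> = (\<integral>\<^sup>+x. ?f x * indicator A x \<partial>lborel)"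
    proof (intro nn_integral_cong)
      fix x
      have "?f x = 2 * ?g x"
        using ennreal_mult'[of 2 "l\<^sup>2 * x * expint_E1 (l * x)"] by (simp add: mult.assoc)
      then show "?g x * indicator A x + ?g x * indicator A x = ?f x * indicator A x"
        by (simp only: mult_2 distrib_right)
    qed
    finally show "emeasure (distr M lborel (\<lambda>\<omega>. X (J \<omega>) 1 \<omega>)) A = emeasure (density lborel ?f) A"
      by (simp add: emeasure_density)
  qed simp
  then show ?thesis
    using Xt by (simp add: distributed_def)
qed

end
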